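(* Let $\alpha>0$ and $\beta\ge 0$. The inequality $|E_{\alpha,\beta}(z)|\le E_{\alpha,\beta}(\Re z)$ holds for all $z\in\mathbb{C}$ if and only if $0<\alpha\le 1$ and $\beta\ge\alpha$.
   Context: For $\alpha>0$ and $\beta\in\mathbb{R}$, the two-parameter Mittag-Leffler function is the entire function $E_{\alpha,\beta}(z)=\sum_{k=0}^{\infty}\frac{z^k}{\Gamma(\alpha k+\beta)}$, $z\in\mathbb{C}$, with the convention $1/\Gamma(s)=0$ at the poles $s=0,-1,-2,\dots$ of $\Gamma$. $\Re z$ denotes the real part of $z$; $E_{\alpha,\beta}$ is real-valued on $\mathbb{R}$. *)

theory Defs
  imports "HOL-Analysis.Analysis"
begin

(* rGamma is the reciprocal Gamma function; it is 0 at the poles 0, -1, -2, ... of Gamma.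
   For \<alpha> > 0 the series converges for every z. *)
definition mittag_leffler :: "real \<Rightarrow> real \<Rightarrow> complex \<Rightarrow> complex" where
  "mittag_leffler \<alpha> \<beta> z = (\<Sum>k. complex_of_real (rGamma (\<alpha> * real k + \<beta>)) * z ^ k)"

end

theory Submission
  imports Defs
begin

text \<open>
  For sufficiency, approximate \<open>E\<^bsub>\<alpha>,\<beta>\<^esub>(z)\<close> by replacing each \<open>1/\<Gamma>(\<alpha>k + \<beta>)\<close> with the \<open>n\<close>-th term of Euler's
  product. Up to a positive factor and the rescaling \<open>w = z n\<^bsup>-\<alpha>\<^esup>\<close>, this approximation is the coefficient
  of \<open>\<zeta>\<^bsup>n+1\<^esup>\<close> in \<open>(1 - \<zeta>)\<^bsup>\<alpha>-\<beta>\<^esup> / ((1 - \<zeta>)\<^sup>\<alpha> - w)\<close>. Writing \<open>(1 - \<zeta>)\<^sup>\<alpha> = 1 - P(\<zeta>)\<close>, both \<open>P\<close> and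
  \<open>(1 - \<zeta>)\<^bsup>\<alpha>-\<beta>\<^esup>\<close> have nonnegative coefficients when \<open>\<alpha> \<le> 1\<close> and \<open>\<beta> \<ge> \<alpha>\<close>, so these coefficients are
  nonnegative combinations of powers of \<open>1/(1 - w)\<close> and inherit \<open>\<bar>1/(1 - w)\<bar> \<le> 1/(1 - Re w)\<close>.

  For necessity, the inequality makes \<open>E\<close> nonnegative and log-convex on the real line. Log-convexity
  forces at least exponential growth, which is impossible for \<open>\<alpha> > 1\<close>. If \<open>\<alpha> \<le> 1\<close> and \<open>\<beta> < \<alpha>\<close>,
  nonnegativity on the negative axis contradicts the decay there of the Mittag-Leffler function
  with second parameter \<open>\<beta> + 2\<close>.
\<close>

section \<open>Binomial coefficients and the inequality for their generating series\<close>

text \<open>The coefficient of \<open>x\<^sup>m\<close> in \<open>(1 - x)\<^bsup>-s\<^esup>\<close>.\<close>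
definition neg_binom :: "real \<Rightarrow> nat \<Rightarrow> real" where
  "neg_binom s m = pochhammer s m / fact m"

text \<open>This is the coefficient of x^m in (1 - x)^(\<alpha> - \<beta>) / ((1 - x)^\<alpha> - w),
  expanded in powers of w. The type is generic so that \<open>w\<close> and \<open>Re w\<close>
  share the same lemmas.\<close>

definition neg_binom_series ::
    "real \<Rightarrow> real \<Rightarrow> nat \<Rightarrow> 'a::{real_normed_field,banach} \<Rightarrow> 'a" where
  "neg_binom_series \<alpha> \<beta> m w = (\<Sum>k. of_real (neg_binom (\<alpha> * real k + \<beta>) m) * w ^ k)"

lemma neg_binom_nonneg: "s \<ge> 0 \<Longrightarrow> neg_binom s m \<ge> 0"
  by (simp add: neg_binom_def pochhammer_prod prod_nonneg)

lemma rGamma_series_nonneg: "(s::real) \<ge> 0 \<Longrightarrow> rGamma_series s n \<ge> 0"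
  by (simp add: rGamma_series_def pochhammer_prod prod_nonneg)

text \<open>The first factor \<open>s\<close> of the rising factorial is nonpositive, all later ones
  are nonnegative. With s = -\<alpha> this gives the sign of the nonconstant coefficients of (1 -
  x)^\<alpha>, and here \<alpha> \<le> 1 enters.\<close>

lemma neg_binom_nonpos:
  assumes "-1 \<le> s" "s \<le> 0" "m > 0"
  shows "neg_binom s m \<le> 0"
proof -
  obtain n where m: "m = Suc n" using assms by (cases m) auto
  have "s * pochhammer (s + 1) n \<le> 0"
    using assms by (intro mult_nonpos_nonneg prod_nonneg) (auto simp: pochhammer_prod intro!: prod_nonneg)
  thus ?thesis by (simp add: neg_binom_def m pochhammer_rec divide_nonpos_pos)
qed

lemma neg_binom_vandermonde:
  "neg_binom (a + b) m = (\<Sum>i\<le>m. neg_binom a i * neg_binom b (m - i))"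
  unfolding neg_binom_def pochhammer_binomial_sum sum_divide_distrib
  by (intro sum.cong) (auto simp: binomial_fact field_simps)

text \<open>A factor k in the coefficients amounts to w times termwise differentiation, which
  preserves convergence in the unit disc.\<close>

lemma summable_index_times_powser:
  fixes w :: "'a::{real_normed_field,banach}"
  assumes "\<And>w. norm w < 1 \<Longrightarrow> summable (\<lambda>k. u k * w ^ k)" "norm w < 1"
  shows "summable (\<lambda>k. of_nat k * u k * w ^ k)"
proof -
  have "summable (\<lambda>k. diffs u k * w ^ k * w)"
    by (intro summable_mult2 termdiff_converges[where K = 1]) (use assms in auto)
  hence "summable (\<lambda>k. of_nat (Suc k) * u (Suc k) * w ^ Suc k)"
    by (simp add: diffs_def mult_ac)
  thus ?thesis by (subst (asm) summable_Suc_iff)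
qed

text \<open>Each new factor of the rising factorial is affine in k, so induction on \<open>m\<close>
  reduces to the previous lemma.\<close>

lemma summable_pochhammer_powser:
  fixes w :: "'a::{real_normed_field,banach}"
  assumes "norm w < 1"
  shows "summable (\<lambda>k. of_real (pochhammer (\<alpha> * real k + \<beta>) m) * w ^ k)"
  using assms
proof (induction m arbitrary: w)
  case 0
  thus ?case by (simp add: summable_geometric)
next
  case (Suc m)
  let ?u = "\<lambda>k. of_real (pochhammer (\<alpha> * real k + \<beta>) m) :: 'a"
  have "summable (\<lambda>k. of_real \<alpha> * (of_nat k * ?u k * w ^ k) + of_real (\<beta> + m) * (?u k * w ^ k))"
    by (intro summable_add summable_mult summable_index_times_powser Suc)
  thus ?case by (simp add: pochhammer_Suc algebra_simps)
qed

lemma summable_neg_binom_series: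
  fixes w :: "'a::{real_normed_field,banach}"
  assumes "norm w < 1"
  shows "summable (\<lambda>k. of_real (neg_binom (\<alpha> * real k + \<beta>) m) * w ^ k)"
  using summable_mult[OF summable_pochhammer_powser[OF assms, of \<alpha> \<beta> m], of "1 / of_real (fact m)"]
  by (simp add: neg_binom_def)

text \<open>Compare coefficients of x^m in (1 - P(x) - w) S(x) = (1 - x)^(\<alpha> - \<beta>), where
  (1 - x)^\<alpha> = 1 - P(x) and S generates the series. As P(0) = 0, only smaller indices remain
  on the right.\<close>

lemma neg_binom_series_rec:
  fixes w :: "'a::{real_normed_field,banach}"
  assumes "norm w < 1"
  shows "(1 - w) * neg_binom_series \<alpha> \<beta> m w =
           of_real (neg_binom (\<beta> - \<alpha>) m) +
           (\<Sum>i=1..m. of_real (- neg_binom (-\<alpha>) i) * neg_binom_series \<alpha> \<beta> (m - i) w)"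
proof -
  let ?S = "neg_binom_series \<alpha> \<beta>"
  let ?t = "\<lambda>m k. of_real (neg_binom (\<alpha> * real k + \<beta>) m) * w ^ k"
  \<comment> \<open>The series with \<beta> lowered by \<alpha> is computed twice: by splitting off
    k = 0, and by convolution with the coefficients of (1 - x)^\<alpha>.\<close>
  define u where "u k = (of_real (neg_binom (\<alpha> * real k + (\<beta> - \<alpha>)) m) :: 'a)" for k
  note summ = summable_neg_binom_series[OF assms]
  have u_Suc: "u (Suc k) = of_real (neg_binom (\<alpha> * real k + \<beta>) m)" for k
    by (simp add: u_def algebra_simps)
  have "summable (\<lambda>k. u k * w ^ k)"
    unfolding u_def by (rule summ)
  from powser_split_head(1)[OF this]
  have 1: "(\<Sum>k. u k * w ^ k) = of_real (neg_binom (\<beta> - \<alpha>) m) + ?S m w * w"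
    unfolding u_Suc by (simp add: neg_binom_series_def u_def)
  have split: "{..m} = insert 0 {1..m}" by auto
  have "neg_binom (\<alpha> * real k + (\<beta> - \<alpha>)) m = neg_binom (\<alpha> * real k + \<beta>) m +
      (\<Sum>i=1..m. neg_binom (-\<alpha>) i * neg_binom (\<alpha> * real k + \<beta>) (m - i))" for k
    using neg_binom_vandermonde[of "-\<alpha>" "\<alpha> * real k + \<beta>" m]
    unfolding split by (simp add: neg_binom_def algebra_simps)
  hence "(\<Sum>k. u k * w ^ k) =
      (\<Sum>k. ?t m k + (\<Sum>i=1..m. of_real (neg_binom (-\<alpha>) i) * ?t (m - i) k))"
    by (simp add: u_def ring_distribs sum_distrib_right mult.assoc)
  also have "\<dots> = ?S m w + (\<Sum>i=1..m. of_real (neg_binom (-\<alpha>) i) * ?S (m - i) w)"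
    by (subst suminf_add [symmetric])
       (simp_all add: suminf_sum suminf_mult neg_binom_series_def summable_sum summable_mult summ)
  finally show ?thesis
    unfolding 1 by (simp add: algebra_simps sum_negf)
qed

text \<open>All coefficients on the right of the recursion are nonnegative, so the triangle
  inequality carries the bound over from smaller indices; on the left, |1 - w| \<ge> 1 - Re w >
  0.\<close>

lemma norm_neg_binom_series_le:
  fixes w :: complex
  assumes "0 < \<alpha>" "\<alpha> \<le> 1" "\<alpha> \<le> \<beta>" "norm w < 1"
  shows "norm (neg_binom_series \<alpha> \<beta> m w) \<le> neg_binom_series \<alpha> \<beta> m (Re w)"
proof (induction m rule: less_induct)
  case (less m)
  have Re: "\<bar>Re w\<bar> < 1" using abs_Re_le_cmod[of w] assms by linarith
  have p: "neg_binom (-\<alpha>) i \<le> 0" if "i \<in> {1..m}" for i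
    using that assms by (intro neg_binom_nonpos) auto
  have "(1 - Re w) * norm (neg_binom_series \<alpha> \<beta> m w)
      \<le> norm (1 - w) * norm (neg_binom_series \<alpha> \<beta> m w)"
    using complex_Re_le_cmod[of "1 - w"] by (intro mult_right_mono) auto
  also have "\<dots> = norm (complex_of_real (neg_binom (\<beta> - \<alpha>) m) +
           (\<Sum>i=1..m. of_real (- neg_binom (-\<alpha>) i) * neg_binom_series \<alpha> \<beta> (m - i) w))"
    using assms by (simp only: neg_binom_series_rec flip: norm_mult)
  also have "\<dots> \<le> norm (complex_of_real (neg_binom (\<beta> - \<alpha>) m)) +
           (\<Sum>i=1..m. norm (of_real (- neg_binom (-\<alpha>) i) * neg_binom_series \<alpha> \<beta> (m - i) w))"
    by (intro order.trans[OF norm_triangle_ineq] add_left_mono norm_sum)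
  also have "\<dots> \<le> neg_binom (\<beta> - \<alpha>) m +
           (\<Sum>i=1..m. - neg_binom (-\<alpha>) i * neg_binom_series \<alpha> \<beta> (m - i) (Re w))"
  proof (intro add_mono sum_mono)
    fix i assume i: "i \<in> {1..m}"
    have "norm (neg_binom_series \<alpha> \<beta> (m - i) w) \<le> neg_binom_series \<alpha> \<beta> (m - i) (Re w)"
      by (rule less) (use i in auto)
    thus "norm (of_real (- neg_binom (-\<alpha>) i) * neg_binom_series \<alpha> \<beta> (m - i) w)
        \<le> - neg_binom (-\<alpha>) i * neg_binom_series \<alpha> \<beta> (m - i) (Re w)"
      using p[OF i] by (simp add: norm_mult abs_if mult_left_mono_neg mult_left_mono)
  qed (use assms in \<open>simp add: neg_binom_nonneg\<close>)
  also have "\<dots> = (1 - Re w) * neg_binom_series \<alpha> \<beta> m (Re w)"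
    using neg_binom_series_rec[of "Re w" \<alpha> \<beta> m] Re by simp
  finally show ?case
    by (rule mult_left_le_imp_le) (use Re in simp)
qed

section \<open>Euler's product for the reciprocal Gamma function and its limit\<close>

text \<open>The quotient of consecutive terms is (1 + s/(n+1)) (n/(n+1))^s, at most exp(s/(n+1))
  exp(-s/(n+1)) = 1.\<close>

lemma rGamma_series_decreasing:
  fixes s :: real
  assumes "s \<ge> 0" "n > 0"
  shows "rGamma_series s (Suc n) \<le> rGamma_series s n"
proof -
  have "ln (real n / real (Suc n)) \<le> real n / real (Suc n) - 1"
    using assms by (intro ln_le_minus_one) auto
  also have "\<dots> = - (1 / real (Suc n))" by (simp add: field_simps)
  finally have "s * (ln (real n) - ln (real (Suc n))) \<le> s * (- (1 / real (Suc n)))"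
    using assms by (intro mult_left_mono) (simp_all add: ln_div)
  hence "(1 + s / real (Suc n)) * exp (s * (ln (real n) - ln (real (Suc n))))
      \<le> exp (s / real (Suc n)) * exp (- s / real (Suc n))"
    using assms by (intro mult_mono exp_ge_add_one_self) auto
  hence le1: "(1 + s / real (Suc n)) * exp (s * (ln (real n) - ln (real (Suc n)))) \<le> 1"
    by (simp flip: exp_add)
  have "rGamma_series s (Suc n) = rGamma_series s n *
      ((1 + s / real (Suc n)) * exp (s * (ln (real n) - ln (real (Suc n)))))"
    using assms
    by (simp add: rGamma_series_def pochhammer_Suc[of s "Suc n"] right_diff_distrib exp_diff
          divide_simps del: of_nat_Suc)
  also have "\<dots> \<le> rGamma_series s n * 1"
    using assms by (intro mult_left_mono le1 rGamma_series_nonneg)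
  finally show ?thesis by simp
qed

lemma rGamma_series_antimono:
  fixes s :: real
  assumes "s \<ge> 0" "0 < m" "m \<le> n"
  shows "rGamma_series s n \<le> rGamma_series s m"
  using assms(3)
proof (induction n rule: dec_induct)
  case (step n)
  thus ?case using rGamma_series_decreasing[of s n] assms by simp
qed auto

text \<open>The n-th term contains a rising factorial of n + 1 factors over n!, hence the index
  \<open>Suc n\<close> and the extra factor \<open>Suc n\<close>.\<close>

lemma rGamma_series_eq_neg_binom:
  assumes "n > 0"
  shows "rGamma_series s n = real (Suc n) * real n powr (-s) * neg_binom s (Suc n)"
  using assms
  by (simp add: rGamma_series_def neg_binom_def powr_def exp_minus divide_simps del: of_nat_Suc)

lemma rGamma_series_powser_term:
  fixes z :: "'a::{real_normed_field,banach}"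
  assumes "n > 0"
  shows "of_real (rGamma_series (\<alpha> * real k + \<beta>) n) * z ^ k =
           of_real (real (Suc n) * real n powr (-\<beta>)) *
             (of_real (neg_binom (\<alpha> * real k + \<beta>) (Suc n)) * (z * of_real (real n powr (-\<alpha>))) ^ k)"
proof -
  have "real n powr (-(\<alpha> * real k + \<beta>)) = real n powr (-\<beta>) * (real n powr (-\<alpha>)) ^ k"
    using assms by (simp add: powr_powr algebra_simps flip: powr_add powr_realpow)
  thus ?thesis
    using assms by (simp add: rGamma_series_eq_neg_binom power_mult_distrib del: of_nat_Suc)
qed

lemma eventually_norm_scaled_less_1:
  fixes z :: "'a::{real_normed_field,banach}"
  assumes "\<alpha> > 0"
  shows "\<forall>\<^sub>F n in sequentially. norm (z * of_real (real n powr (-\<alpha>))) < 1"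
proof -
  have "(\<lambda>n. real n powr (-\<alpha>)) \<longlonglongrightarrow> 0"
    using assms by (intro tendsto_neg_powr filterlim_real_sequentially) auto
  hence "(\<lambda>n. norm (z * of_real (real n powr (-\<alpha>)))) \<longlonglongrightarrow> norm (z * of_real 0)"
    by (intro tendsto_intros)
  thus ?thesis by (rule order_tendstoD) simp
qed

text \<open>Tannery's theorem: by monotonicity in n the terms at a fixed \<open>N\<close> dominate
  all later ones, and they are summable once z N^(-\<alpha>) lies in the unit disc.\<close>

lemma rGamma_powser_limit:
  fixes z :: "'a::{real_normed_field,banach}"
  assumes "\<alpha> > 0" "\<beta> \<ge> 0"
  shows "summable (\<lambda>k. norm (of_real (rGamma (\<alpha> * real k + \<beta>)) * z ^ k))"
    and "(\<lambda>n. of_real (real (Suc n) * real n powr (-\<beta>)) *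
              neg_binom_series \<alpha> \<beta> (Suc n) (z * of_real (real n powr (-\<alpha>))))
           \<longlonglongrightarrow> (\<Sum>k. of_real (rGamma (\<alpha> * real k + \<beta>)) * z ^ k)"
proof -
  let ?a = "\<lambda>k n. of_real (rGamma_series (\<alpha> * real k + \<beta>) n) * z ^ k"
  obtain N where N: "N > 0" "norm (z * of_real (real N powr (-\<alpha>))) < 1"
    using eventually_conj[OF eventually_gt_at_top[of 0] eventually_norm_scaled_less_1[OF assms(1), of z]]
    unfolding eventually_sequentially by blast
  define M where "M k = norm (?a k N)" for k
  have "norm (?a k n) \<le> M k" if "n \<ge> N" for k n
    unfolding M_def norm_mult
    using rGamma_series_antimono[of "\<alpha> * real k + \<beta>" N n] N assms that
    by (intro mult_right_mono) (auto simp: rGamma_series_nonneg)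
  hence bound: "\<forall>\<^sub>F (k, n) in at_top \<times>\<^sub>F sequentially. norm (?a k n) \<le> M k"
    unfolding eventually_prod_filter
    by (intro exI[of _ "\<lambda>_. True"] exI[of _ "\<lambda>n. n \<ge> N"]) (auto intro: eventually_ge_at_top)
  have "summable (\<lambda>k. (real (Suc N) * real N powr (-\<beta>)) *
      (neg_binom (\<alpha> * real k + \<beta>) (Suc N) * (norm (z * of_real (real N powr (-\<alpha>)))) ^ k))"
    using summable_neg_binom_series[of "norm (z * of_real (real N powr (-\<alpha>)))" \<alpha> \<beta> "Suc N"] N
    by (intro summable_mult) simp
  hence "summable M"
    unfolding M_def rGamma_series_powser_term[OF N(1)] 
    using assms by (simp add: norm_mult norm_power neg_binom_nonneg add_nonneg_nonneg del: of_nat_Suc)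
  have lim: "(\<lambda>n. ?a k n) \<longlonglongrightarrow> of_real (rGamma (\<alpha> * real k + \<beta>)) * z ^ k" for k
    by (intro tendsto_intros)
  note T = tannerys_theorem[OF lim bound \<open>summable M\<close> sequentially_bot]
  show "summable (\<lambda>k. norm (of_real (rGamma (\<alpha> * real k + \<beta>)) * z ^ k))"
    using T by blast
  have "\<forall>\<^sub>F n in sequentially. (\<Sum>k. ?a k n) = of_real (real (Suc n) * real n powr (-\<beta>)) *
              neg_binom_series \<alpha> \<beta> (Suc n) (z * of_real (real n powr (-\<alpha>)))"
    using eventually_gt_at_top[of 0] eventually_norm_scaled_less_1[OF assms(1), of z]
    by eventually_elim
       (simp only: rGamma_series_powser_term neg_binom_series_def suminf_mult summable_neg_binom_series)
  thus "(\<lambda>n. of_real (real (Suc n) * real n powr (-\<beta>)) *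
              neg_binom_series \<alpha> \<beta> (Suc n) (z * of_real (real n powr (-\<alpha>))))
           \<longlonglongrightarrow> (\<Sum>k. of_real (rGamma (\<alpha> * real k + \<beta>)) * z ^ k)"
    using T by (blast intro: Lim_transform_eventually)
qed

section \<open>The function on the real line, and sufficiency\<close>

definition mittag_leffler_real :: "real \<Rightarrow> real \<Rightarrow> real \<Rightarrow> real" where
  "mittag_leffler_real \<alpha> \<beta> x = (\<Sum>k. rGamma (\<alpha> * real k + \<beta>) * x ^ k)"

lemma summable_rGamma_powser:
  fixes z :: "'a::{real_normed_field,banach}"
  assumes "\<alpha> > 0" "\<beta> \<ge> 0"
  shows "summable (\<lambda>k. of_real (rGamma (\<alpha> * real k + \<beta>)) * z ^ k)"
  using rGamma_powser_limit(1)[OF assms] by (rule summable_norm_cancel)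

lemma mittag_leffler_of_real:
  assumes "\<alpha> > 0" "\<beta> \<ge> 0"
  shows "mittag_leffler \<alpha> \<beta> (of_real x) = of_real (mittag_leffler_real \<alpha> \<beta> x)"
  using suminf_of_real[OF summable_rGamma_powser[OF assms, of x], where ?'a = complex]
  by (simp add: mittag_leffler_def mittag_leffler_real_def)

text \<open>The scaling n^(-\<alpha>) is real and thus commutes with \<open>Re\<close>, so the bound
  for \<open>neg_binom_series\<close> passes to the limit.\<close>

lemma norm_mittag_leffler_le:
  assumes "0 < \<alpha>" "\<alpha> \<le> 1" "\<alpha> \<le> \<beta>"
  shows "norm (mittag_leffler \<alpha> \<beta> z) \<le> mittag_leffler_real \<alpha> \<beta> (Re z)"
proof (rule tendsto_le[OF sequentially_bot])
  have "\<beta> \<ge> 0" using assms by simp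
  note lim = rGamma_powser_limit(2)[OF assms(1) this]
  let ?W = "\<lambda>n z. z * of_real (real n powr (-\<alpha>))"
  let ?c = "\<lambda>n. real (Suc n) * real n powr (-\<beta>)"
  show "(\<lambda>n. ?c n * neg_binom_series \<alpha> \<beta> (Suc n) (?W n (Re z))) \<longlonglongrightarrow> mittag_leffler_real \<alpha> \<beta> (Re z)"
    using lim[of "Re z"] by (simp add: mittag_leffler_real_def)
  show "(\<lambda>n. norm (of_real (?c n) * neg_binom_series \<alpha> \<beta> (Suc n) (?W n z)))
      \<longlonglongrightarrow> norm (mittag_leffler \<alpha> \<beta> z)"
    unfolding mittag_leffler_def by (intro tendsto_norm lim)
  show "\<forall>\<^sub>F n in sequentially. norm (of_real (?c n) * neg_binom_series \<alpha> \<beta> (Suc n) (?W n z))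
      \<le> ?c n * neg_binom_series \<alpha> \<beta> (Suc n) (?W n (Re z))"
    using eventually_norm_scaled_less_1[OF assms(1), of z]
  proof eventually_elim
    case (elim n)
    show ?case
      using norm_neg_binom_series_le[OF assms elim, of "Suc n"]
      by (simp add: norm_mult mult_left_mono del: of_nat_Suc)
  qed
qed

section \<open>Log-convexity on the real line\<close>

lemma has_field_derivative_vertical_line:
  assumes "(f has_field_derivative f') (at (Complex x y))"
  shows "((\<lambda>t. f (Complex x t)) has_vector_derivative (\<i> * f')) (at y)"
proof -
  have "((\<lambda>t. of_real x + of_real t * \<i>) has_vector_derivative \<i>) (at y)"
    by (auto intro!: derivative_eq_intros)
  hence "((\<lambda>t. Complex x t) has_vector_derivative \<i>) (at y)"
    by (simp add: Complex_eq[abs_def] mult.commute)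
  from field_vector_diff_chain_at[OF this assms] show ?thesis
    by (simp add: o_def)
qed

text \<open>The second-order term of \<open>\<bar>f (x + \<i> y)\<bar>\<^sup>2\<close> in \<open>y\<close> is \<open>f'(x)\<^sup>2 - f(x) f''(x)\<close>.\<close>
lemma log_convex_of_norm_le:
  fixes f f' f'' :: "complex \<Rightarrow> complex"
  assumes f: "\<And>z. (f has_field_derivative f' z) (at z)"
    and f': "\<And>z. (f' has_field_derivative f'' z) (at z)"
    and real: "f (of_real x) = of_real a" "f' (of_real x) = of_real b" "f'' (of_real x) = of_real c"
    and le: "\<And>y. norm (f (Complex x y)) \<le> a"
  shows "b\<^sup>2 \<le> a * c"
proof (rule ccontr)
  assume "\<not> b\<^sup>2 \<le> a * c"
  hence pos: "0 < 2 * (b\<^sup>2 - a * c)" by simp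
  let ?L = "\<lambda>y. Complex x y"
  have x0: "?L 0 = of_real x" by (simp add: Complex_eq)
  have Re_d: "((\<lambda>y. Re (g (?L y))) has_real_derivative - Im (g' (?L y))) (at y)"
    and Im_d: "((\<lambda>y. Im (g (?L y))) has_real_derivative Re (g' (?L y))) (at y)"
    if "\<And>z. (g has_field_derivative g' z) (at z)" for g g' y
    using bounded_linear.has_vector_derivative[OF bounded_linear_Re
        has_field_derivative_vertical_line[OF that]]
      bounded_linear.has_vector_derivative[OF bounded_linear_Im
        has_field_derivative_vertical_line[OF that]]
    by (simp_all add: has_real_derivative_iff_has_vector_derivative)
  \<comment> \<open>\<open>h\<close> is |f|^2 on the vertical line through \<open>x\<close>. Since
    h'(0) = 0 and h''(0) > 0, it exceeds h(0) = a^2 just above 0, against the bound.\<close>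
  define h where "h y = (Re (f (?L y)))\<^sup>2 + (Im (f (?L y)))\<^sup>2" for y
  define h' where "h' y = 2 * (Im (f (?L y)) * Re (f' (?L y)) - Re (f (?L y)) * Im (f' (?L y)))" for y
  have h: "(h has_real_derivative h' y) (at y)" for y
    unfolding h_def h'_def
    by (rule derivative_eq_intros Re_d[OF f] Im_d[OF f] refl | simp)+
  have h': "(h' has_real_derivative 2 * (b\<^sup>2 - a * c)) (at 0)"
    unfolding h'_def
    by (rule derivative_eq_intros Re_d[OF f] Im_d[OF f] Re_d[OF f'] Im_d[OF f'] refl |
        simp add: x0 real power2_eq_square)+
  have "h' 0 = 0" by (simp add: h'_def x0 real)
  with DERIV_pos_inc_right[OF h' pos] obtain d
    where d: "d > 0" "\<And>t. 0 < t \<Longrightarrow> t < d \<Longrightarrow> h' t > 0" by auto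
  have "h 0 < h (d / 2)"
  proof (rule DERIV_pos_imp_increasing_open[of 0 "d / 2" h])
    show "\<exists>l. (h has_real_derivative l) (at y) \<and> 0 < l" if "0 < y" "y < d / 2" for y
      using h[of y] d(2)[of y] that by auto
    show "continuous_on {0..d / 2} h"
      using DERIV_isCont[OF h] by (intro continuous_at_imp_continuous_on) blast
  qed (use d in simp)
  moreover have "h (d / 2) \<le> a\<^sup>2"
    unfolding h_def using power_mono[OF le[of "d / 2"], of 2]
    by (simp add: cmod_power2)
  moreover have "h 0 = a\<^sup>2" by (simp add: h_def x0 real)
  ultimately show False by simp
qed

text \<open>Log-convexity makes \<open>f'/f\<close> nondecreasing, so \<open>f' \<ge> c f\<close> on \<open>[0, \<infinity>)\<close> for \<open>c = f'(0)/f(0) > 0\<close>,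
  which fails for \<open>x \<rightarrow> \<infinity>\<close> once \<open>(k + 1) a\<^sub>k\<^sub>+\<^sub>1 < c a\<^sub>k\<close> for all large \<open>k\<close>.\<close>
lemma not_log_convex_if_coeffs_decay:
  fixes a :: "nat \<Rightarrow> real"
  assumes summ: "\<And>x. summable (\<lambda>k. a k * x ^ k)"
    and a0: "a 0 \<ge> 0" and a_pos: "\<And>k. k > 0 \<Longrightarrow> a k > 0"
    and decay: "\<And>\<epsilon>. \<epsilon> > 0 \<Longrightarrow> \<forall>\<^sub>F k in sequentially. real (Suc k) * a (Suc k) \<le> \<epsilon> * a k"
    and log_convex: "\<And>x. x \<ge> 0 \<Longrightarrow>
      (\<Sum>k. diffs a k * x ^ k)\<^sup>2 \<le> (\<Sum>k. a k * x ^ k) * (\<Sum>k. diffs (diffs a) k * x ^ k)"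
  shows False
proof -
  define f where "f x = (\<Sum>k. a k * x ^ k)" for x
  define f' where "f' x = (\<Sum>k. diffs a k * x ^ k)" for x
  define f'' where "f'' x = (\<Sum>k. diffs (diffs a) k * x ^ k)" for x
  have summ': "summable (\<lambda>k. diffs a k * x ^ k)" for x
    by (intro termdiff_converges_all summ)
  have f: "(f has_real_derivative f' x) (at x)" for x
    unfolding f_def f'_def by (intro termdiffs_strong_converges_everywhere summ)
  have f': "(f' has_real_derivative f'' x) (at x)" for x
    unfolding f'_def f''_def by (intro termdiffs_strong_converges_everywhere summ')
  have lc: "(f' x)\<^sup>2 \<le> f x * f'' x" if "x \<ge> 0" for x
    using log_convex[OF that] by (simp add: f_def f'_def f''_def)
  \<comment> \<open>At 0 the value is \<open>a 0\<close>; were it 0, log-convexity there would force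
    \<open>a 1\<close> = 0. This settles \<beta> = 0, where \<open>rGamma\<close> vanishes.\<close>
  have f0: "f 0 = a 0" and f'0: "f' 0 = a 1"
    by (simp_all add: f_def f'_def diffs_def)
  have "a 0 \<noteq> 0"
    using lc[of 0] a_pos[of 1] by (auto simp: f0 f'0)
  with a0 a_pos have pos: "a k > 0" for k
    by (cases "k = 0") auto
  have f_pos: "f x > 0" if "x \<ge> 0" for x
  proof -
    have "(\<Sum>k<1. a k * x ^ k) \<le> f x"
      unfolding f_def using pos that by (intro sum_le_suminf summ) (auto simp: less_imp_le)
    with pos[of 0] show ?thesis by simp
  qed
  define c where "c = a 1 / a 0"
  have c: "c > 0" using pos by (simp add: c_def)
  have f'_ge: "c * f x \<le> f' x" if x: "x \<ge> 0" for x
  proof -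
    have "f' 0 / f 0 \<le> f' x / f x"
    proof (rule DERIV_nonneg_imp_nondecreasing[OF x], intro exI conjI)
      fix t :: real assume t: "0 \<le> t"
      have ft: "f t \<noteq> 0" using f_pos[OF t] by simp
      show "((\<lambda>x. f' x / f x) has_real_derivative (f'' t * f t - f' t * f' t) / (f t * f t)) (at t)"
        by (rule DERIV_divide[OF f' f ft])
      show "0 \<le> (f'' t * f t - f' t * f' t) / (f t * f t)"
        using lc[OF t] by (simp add: power2_eq_square mult.commute)
    qed
    thus ?thesis using f_pos[OF x] by (simp add: c_def f0 f'0 field_simps)
  qed
  define d where "d k = diffs a k - c * a k" for k
  have summ_d: "summable (\<lambda>k. d k * x ^ k)" for x
    unfolding d_def left_diff_distrib mult.assoc by (intro summable_diff summable_mult summ summ')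
  have d_sum: "(\<Sum>k. d k * x ^ k) = f' x - c * f x" for x
    unfolding d_def left_diff_distrib f_def f'_def mult.assoc
    by (subst suminf_diff[symmetric]) (auto intro!: summable_mult summ summ' simp: suminf_mult[OF summ])
  \<comment> \<open>Half of \<open>c\<close> is kept as a margin, so that \<open>d k\<close> is
    strictly negative from \<open>K\<close> on.\<close>
  obtain K where decay_K: "\<And>k. k \<ge> K \<Longrightarrow> real (Suc k) * a (Suc k) \<le> c / 2 * a k"
    using decay[of "c / 2"] c unfolding eventually_sequentially by auto
  have K: "d k \<le> - (c / 2) * a k" if "k \<ge> K" for k
    using decay_K[OF that] unfolding d_def diffs_def by linarith
  \<comment> \<open>This polynomial bounds f' - c f from above for x \<ge> 0: terms beyond
    \<open>K\<close> are dropped and term \<open>K\<close> is enlarged. Its leading coefficient is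
    negative, yet f' - c f \<ge> 0.\<close>
  define P where "P x = (\<Sum>k<K. d k * x ^ k) - (c / 2) * a K * x ^ K" for x
  have P_nonneg: "P x \<ge> 0" if x: "x \<ge> 0" for x
  proof -
    have dK: "d k \<le> 0" if "k \<ge> K" for k
      using K[OF that] mult_pos_pos[OF c pos[of k]] by simp
    have "(\<Sum>k. d k * x ^ k) \<le> (\<Sum>k<Suc K. d k * x ^ k)"
      using sum_le_suminf[of "\<lambda>k. - (d k * x ^ k)" "{..<Suc K}"] summable_minus[OF summ_d[of x]] dK x
      by (simp add: suminf_minus[OF summ_d] sum_negf mult_nonpos_nonneg)
    also have "\<dots> \<le> P x"
      using mult_right_mono[OF K[of K], of "x ^ K"] x by (simp add: P_def)
    finally show ?thesis using f'_ge[OF x] by (simp add: d_sum)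
  qed
  have "((\<lambda>x::real. d k * (x ^ k / x ^ K)) \<longlongrightarrow> d k * 0) at_top" if "k < K" for k
  proof (intro tendsto_mult tendsto_const)
    have "((\<lambda>x::real. inverse (x ^ (K - k))) \<longlongrightarrow> 0) at_top"
      using that by (intro tendsto_inverse_0_at_top filterlim_pow_at_top filterlim_ident) auto
    moreover have "\<forall>\<^sub>F x::real in at_top. inverse (x ^ (K - k)) = x ^ k / x ^ K"
      using eventually_gt_at_top[of 0]
      by eventually_elim (use that in \<open>simp add: power_diff field_simps\<close>)
    ultimately show "((\<lambda>x::real. x ^ k / x ^ K) \<longlongrightarrow> 0) at_top"
      by (rule Lim_transform_eventually)
  qed
  hence "((\<lambda>x::real. (\<Sum>k<K. d k * (x ^ k / x ^ K)) - (c / 2) * a K) \<longlongrightarrow>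
      (\<Sum>k<K. d k * 0) - (c / 2) * a K) at_top"
    by (intro tendsto_diff tendsto_sum tendsto_const) auto
  moreover have "\<forall>\<^sub>F x in at_top. 0 \<le> (\<Sum>k<K. d k * (x ^ k / x ^ K)) - (c / 2) * a K"
    using eventually_gt_at_top[of 0]
  proof eventually_elim
    case (elim x)
    have "0 \<le> P x / x ^ K" using P_nonneg elim by simp
    also have "\<dots> = (\<Sum>k<K. d k * (x ^ k / x ^ K)) - (c / 2) * a K"
      using elim by (simp add: P_def diff_divide_distrib sum_divide_distrib)
    finally show ?case .
  qed
  ultimately have "0 \<le> (\<Sum>k<K. d k * 0) - (c / 2) * a K"
    by (intro tendsto_lowerbound) auto
  with mult_pos_pos[OF c pos[of K]] show False by simp
qed

section \<open>Coefficient decay, and the case \<alpha> > 1\<close>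

lemma rGamma_real_pos: "x > 0 \<Longrightarrow> rGamma (x :: real) > 0"
  by (simp add: rGamma_inverse_Gamma Gamma_real_pos)

text \<open>The point s + 1 divides the segment from s to s + \<alpha> with weight 1/\<alpha>;
  log-convexity of Gamma and Gamma(s+1) = s Gamma(s) give the bound.\<close>

lemma rGamma_add_le:
  fixes s \<alpha> :: real
  assumes "s > 0" "\<alpha> \<ge> 1"
  shows "rGamma (s + \<alpha>) \<le> s powr (-\<alpha>) * rGamma s"
proof -
  define t where "t = 1 / \<alpha>"
  have t: "0 \<le> t" "t \<le> 1" using assms by (auto simp: t_def)
  have eq: "(1 - t) *\<^sub>R s + t *\<^sub>R (s + \<alpha>) = s + 1"
    using assms by (simp add: t_def field_simps)
  have "ln (Gamma (s + 1)) \<le> (1 - t) * ln (Gamma s) + t * ln (Gamma (s + \<alpha>))"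
    using convex_onD[OF log_convex_Gamma_real t, of s "s + \<alpha>"] assms unfolding eq by simp
  also have "ln (Gamma (s + 1)) = ln s + ln (Gamma s)"
    using assms Gamma_real_pos[of s] nonpos_Ints_nonpos[of s]
    by (subst Gamma_plus1) (auto simp: ln_mult_pos)
  finally have "ln s + t * ln (Gamma s) \<le> t * ln (Gamma (s + \<alpha>))"
    by (simp add: algebra_simps)
  hence "\<alpha> * (ln s + t * ln (Gamma s)) \<le> \<alpha> * (t * ln (Gamma (s + \<alpha>)))"
    using assms by (intro mult_left_mono) auto
  hence "\<alpha> * ln s + ln (Gamma s) \<le> ln (Gamma (s + \<alpha>))"
    using assms by (simp add: t_def distrib_left)
  hence "exp (- ln (Gamma (s + \<alpha>))) \<le> exp (- \<alpha> * ln s) * exp (- ln (Gamma s))"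
    by (simp flip: exp_add)
  thus ?thesis
    using assms Gamma_real_pos[of s] Gamma_real_pos[of "s + \<alpha>"]
    by (simp add: exp_minus powr_def rGamma_inverse_Gamma)
qed

text \<open>With s = \<alpha> k + \<beta> \<ge> k, the quotient is at most (s + 1) s^(-\<alpha>),
  which tends to 0 because \<alpha> > 1.\<close>

lemma rGamma_coeffs_decay:
  assumes "\<alpha> > 1" "\<beta> \<ge> 0" "\<epsilon> > 0"
  shows "\<forall>\<^sub>F k in sequentially.
    real (Suc k) * rGamma (\<alpha> * real (Suc k) + \<beta>) \<le> \<epsilon> * rGamma (\<alpha> * real k + \<beta>)"
proof -
  let ?s = "\<lambda>k. \<alpha> * real k + \<beta>"
  have "filterlim ?s at_top sequentially"
    using assms
    by (intro filterlim_at_top_mono[OF filterlim_tendsto_pos_mult_at_top[OF tendsto_const _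
          filterlim_real_sequentially, of \<alpha>]]) auto
  hence "(\<lambda>k. ?s k powr (1 - \<alpha>) + ?s k powr (-\<alpha>)) \<longlonglongrightarrow> 0 + 0"
    using assms by (intro tendsto_add tendsto_neg_powr) auto
  hence "\<forall>\<^sub>F k in sequentially. ?s k powr (1 - \<alpha>) + ?s k powr (-\<alpha>) < \<epsilon>"
    using assms by (intro order_tendstoD) auto
  hence "\<forall>\<^sub>F k in sequentially. real (Suc k) * ?s k powr (-\<alpha>) < \<epsilon>"
    using eventually_gt_at_top[of 0]
  proof eventually_elim
    case (elim k)
    have "real k \<le> \<alpha> * real k" using assms mult_right_mono[of 1 \<alpha> "real k"] by simp
    hence k: "real (Suc k) \<le> ?s k + 1" "?s k > 0" using assms elim by linarith+
    have "real (Suc k) * ?s k powr (-\<alpha>) \<le> (?s k + 1) * ?s k powr (-\<alpha>)"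
      using k by (intro mult_right_mono) auto
    also have "\<dots> = ?s k powr (1 - \<alpha>) + ?s k powr (-\<alpha>)"
      using k(2) powr_add[of "?s k" 1 "-\<alpha>"] by (simp add: algebra_simps)
    finally show ?case using elim by simp
  qed
  thus ?thesis
    using eventually_gt_at_top[of 0]
  proof eventually_elim
    case (elim k)
    have s: "\<alpha> * real k + \<beta> > 0" using elim assms by (simp add: add_pos_nonneg)
    have "real (Suc k) * rGamma (\<alpha> * real k + \<beta> + \<alpha>)
        \<le> real (Suc k) * ((\<alpha> * real k + \<beta>) powr (-\<alpha>) * rGamma (\<alpha> * real k + \<beta>))"
      using rGamma_add_le[OF s, of \<alpha>] assms by (intro mult_left_mono) auto
    also have "\<dots> \<le> \<epsilon> * rGamma (\<alpha> * real k + \<beta>)"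
      using elim rGamma_real_pos[OF s] by (simp flip: mult.assoc)
    finally show ?case by (simp add: algebra_simps)
  qed
qed

lemma diffs_of_real: "diffs (\<lambda>k. of_real (a k)) = (\<lambda>k. of_real (diffs a k))"
  by (simp add: diffs_def)

lemma not_norm_le_if_alpha_gt_1:
  assumes "\<alpha> > 1" "\<beta> \<ge> 0"
    and le: "\<And>z. norm (mittag_leffler \<alpha> \<beta> z) \<le> mittag_leffler_real \<alpha> \<beta> (Re z)"
  shows False
proof -
  define a where "a k = rGamma (\<alpha> * real k + \<beta>)" for k
  have "\<alpha> > 0" using assms by simp
  note summ = summable_rGamma_powser[OF this assms(2), folded a_def]
  have summ_C: "summable (\<lambda>k. complex_of_real (a k) * z ^ k)" for z by (rule summ)
  have summ_C': "summable (\<lambda>k. complex_of_real (diffs a k) * z ^ k)" for z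
    using termdiff_converges_all[OF summ_C] by (simp add: diffs_of_real)
  have summ_R: "summable (\<lambda>k. a k * x ^ k)" for x using summ[of x] by simp
  have summ_R': "summable (\<lambda>k. diffs a k * x ^ k)" for x
    by (intro termdiff_converges_all summ_R)
  have summ_R'': "summable (\<lambda>k. diffs (diffs a) k * x ^ k)" for x
    by (intro termdiff_converges_all summ_R')
  have of_real_sum: "(\<Sum>k. complex_of_real (u k) * of_real x ^ k) = of_real (\<Sum>k. u k * x ^ k)"
    if "summable (\<lambda>k. u k * x ^ k)" for u x
    using suminf_of_real[OF that, where ?'a = complex] by simp
  show False
  proof (rule not_log_convex_if_coeffs_decay[of a])
    show "summable (\<lambda>k. a k * x ^ k)" for x by (rule summ_R)
    show "a k > 0" if "k > 0" for k
      unfolding a_def using that assms by (intro rGamma_real_pos add_pos_nonneg) auto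
    show "a 0 \<ge> 0"
      using assms rGamma_real_pos[of \<beta>] by (cases "\<beta> = 0") (auto simp: a_def)
    show "\<forall>\<^sub>F k in sequentially. real (Suc k) * a (Suc k) \<le> \<epsilon> * a k" if "\<epsilon> > 0" for \<epsilon>
      unfolding a_def by (rule rGamma_coeffs_decay[OF assms(1,2) that])
    show "(\<Sum>k. diffs a k * x ^ k)\<^sup>2 \<le> (\<Sum>k. a k * x ^ k) * (\<Sum>k. diffs (diffs a) k * x ^ k)" for x
    proof (rule log_convex_of_norm_le)
      show "((\<lambda>z. \<Sum>k. complex_of_real (a k) * z ^ k) has_field_derivative
          (\<Sum>k. complex_of_real (diffs a k) * z ^ k)) (at z)" for z
        using termdiffs_strong_converges_everywhere[OF summ_C] by (simp add: diffs_of_real)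
      show "((\<lambda>z. \<Sum>k. complex_of_real (diffs a k) * z ^ k) has_field_derivative
          (\<Sum>k. complex_of_real (diffs (diffs a) k) * z ^ k)) (at z)" for z
        using termdiffs_strong_converges_everywhere[OF summ_C'] by (simp add: diffs_of_real)
      show "norm (\<Sum>k. complex_of_real (a k) * Complex x y ^ k) \<le> (\<Sum>k. a k * x ^ k)" for y
        using le[of "Complex x y"] by (simp add: mittag_leffler_def mittag_leffler_real_def a_def)
    qed (intro of_real_sum summ_R summ_R' summ_R'')+
  qed
qed

section \<open>Recurrences in the second parameter, and the case \<beta> < \<alpha>\<close>

lemma mittag_leffler_real_rec:
  assumes "\<alpha> > 0" "\<beta> \<ge> 0"
  shows "mittag_leffler_real \<alpha> \<beta> x = rGamma \<beta> + x * mittag_leffler_real \<alpha> (\<beta> + \<alpha>) x"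
  using powser_split_head(1)[OF summable_rGamma_powser[OF assms, of x, simplified]]
  by (simp add: mittag_leffler_real_def algebra_simps)

lemma mittag_leffler_real_0: "mittag_leffler_real \<alpha> \<beta> 0 = rGamma \<beta>"
  by (simp add: mittag_leffler_real_def)

text \<open>Termwise this is s \<open>rGamma\<close> (s + 1) = \<open>rGamma\<close> s at s =
  \<alpha> k + \<beta>, valid also at s = 0; the factor k comes from x times the derivative.\<close>

lemma mittag_leffler_real_deriv:
  assumes "\<alpha> > 0" "\<beta> \<ge> 0"
  obtains D where "(mittag_leffler_real \<alpha> (\<beta> + 1) has_real_derivative D) (at x)"
    "\<beta> * mittag_leffler_real \<alpha> (\<beta> + 1) x + \<alpha> * x * D = mittag_leffler_real \<alpha> \<beta> x"
proof -
  let ?a = "\<lambda>k. rGamma (\<alpha> * real k + (\<beta> + 1))"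
  have summ: "summable (\<lambda>k. ?a k * x ^ k)" for x
    using summable_rGamma_powser[of \<alpha> "\<beta> + 1" x] assms by simp
  define D where "D = (\<Sum>k. diffs ?a k * x ^ k)"
  have 1: "(mittag_leffler_real \<alpha> (\<beta> + 1) has_real_derivative D) (at x)"
    unfolding mittag_leffler_real_def D_def by (intro termdiffs_strong_converges_everywhere summ)
  have "(\<lambda>k. diffs ?a k * x ^ k * x) sums (D * x)"
    unfolding D_def by (intro sums_mult2 summable_sums termdiff_converges_all summ)
  hence "(\<lambda>k. real (Suc k) * ?a (Suc k) * x ^ Suc k) sums (D * x)"
    by (simp add: diffs_def mult_ac)
  from sums_Suc[OF this] have "(\<lambda>k. real k * ?a k * x ^ k) sums (D * x)" by simp
  hence "(\<lambda>k. \<beta> * (?a k * x ^ k) + \<alpha> * (real k * ?a k * x ^ k)) sums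
      (\<beta> * mittag_leffler_real \<alpha> (\<beta> + 1) x + \<alpha> * (D * x))"
    unfolding mittag_leffler_real_def by (intro sums_add sums_mult summable_sums summ)
  moreover have "\<beta> * (?a k * x ^ k) + \<alpha> * (real k * ?a k * x ^ k) = rGamma (\<alpha> * real k + \<beta>) * x ^ k" for k
  proof -
    have "\<beta> * (a * y) + \<alpha> * (r * a * y) = (\<alpha> * r + \<beta>) * a * y" for a y r
      by (simp add: algebra_simps)
    also have "(\<alpha> * real k + \<beta>) * ?a k = rGamma (\<alpha> * real k + \<beta>)"
      using rGamma_plus1[of "\<alpha> * real k + \<beta>"] by (simp only: add.assoc)
    finally show ?thesis .
  qed
  ultimately have "\<beta> * mittag_leffler_real \<alpha> (\<beta> + 1) x + \<alpha> * (D * x) = mittag_leffler_real \<alpha> \<beta> x"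
    unfolding mittag_leffler_real_def by (simp add: sums_iff)
  with 1 that show ?thesis by (simp add: mult_ac)
qed

text \<open>Raising \<beta> by 1 thus means integrating in t. After the product rule, t^(\<beta> -
  1) times the previous identity remains.\<close>

lemma powr_mittag_leffler_deriv:
  assumes "\<alpha> > 0" "\<beta> \<ge> 0" "t > 0"
  shows "((\<lambda>t. t powr \<beta> * mittag_leffler_real \<alpha> (\<beta> + 1) (- (t powr \<alpha>))) has_real_derivative
           t powr (\<beta> - 1) * mittag_leffler_real \<alpha> \<beta> (- (t powr \<alpha>))) (at t)"
proof -
  obtain D where D: "(mittag_leffler_real \<alpha> (\<beta> + 1) has_real_derivative D) (at (- (t powr \<alpha>)))"
    "\<beta> * mittag_leffler_real \<alpha> (\<beta> + 1) (- (t powr \<alpha>)) + \<alpha> * (- (t powr \<alpha>)) * D =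
       mittag_leffler_real \<alpha> \<beta> (- (t powr \<alpha>))"
    using mittag_leffler_real_deriv[OF assms(1,2)] by blast
  have inner: "((\<lambda>t. - (t powr \<alpha>)) has_real_derivative - (\<alpha> * t powr (\<alpha> - 1))) (at t)"
    using assms by (auto intro!: derivative_eq_intros)
  have "((\<lambda>t. t powr \<beta> * mittag_leffler_real \<alpha> (\<beta> + 1) (- (t powr \<alpha>))) has_real_derivative
      (\<beta> * t powr (\<beta> - 1)) * mittag_leffler_real \<alpha> (\<beta> + 1) (- (t powr \<alpha>)) +
      (D * - (\<alpha> * t powr (\<alpha> - 1))) * t powr \<beta>) (at t)"
    by (intro DERIV_mult has_real_derivative_powr assms DERIV_chain2[OF D(1) inner])
  also have "(\<beta> * t powr (\<beta> - 1)) * mittag_leffler_real \<alpha> (\<beta> + 1) (- (t powr \<alpha>)) +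
      (D * - (\<alpha> * t powr (\<alpha> - 1))) * t powr \<beta> =
      t powr (\<beta> - 1) * mittag_leffler_real \<alpha> \<beta> (- (t powr \<alpha>))"
    unfolding D(2)[symmetric] using assms by (simp add: powr_diff field_simps)
  finally show ?thesis .
qed

text \<open>Nonnegativity on the negative axis makes \<open>G(t) = t\<^sup>\<beta> E\<^bsub>\<alpha>,\<beta>+1\<^esub>(-t\<^sup>\<alpha>)\<close> nondecreasing, so its
  antiderivative \<open>H(t) = t\<^bsup>\<beta>+1\<^esup> E\<^bsub>\<alpha>,\<beta>+2\<^esub>(-t\<^sup>\<alpha>)\<close> grows at least linearly; yet
  \<open>E\<^bsub>\<alpha>,\<beta>+2-\<alpha>\<^esub> \<ge> 0\<close> forces \<open>H(t) = O(t\<^bsup>\<beta>+1-\<alpha>\<^esup>)\<close>.\<close>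
lemma not_nonneg_if_beta_less_alpha:
  assumes "0 < \<alpha>" "\<alpha> \<le> 1" "0 \<le> \<beta>" "\<beta> < \<alpha>"
    and nonneg: "\<And>x. mittag_leffler_real \<alpha> \<beta> x \<ge> 0"
  shows False
proof -
  let ?F = "mittag_leffler_real \<alpha>"
  define G where "G t = t powr \<beta> * ?F (\<beta> + 1) (- (t powr \<alpha>))" for t
  define H where "H t = t powr (\<beta> + 1) * ?F (\<beta> + 2) (- (t powr \<alpha>))" for t
  have G: "(G has_real_derivative t powr (\<beta> - 1) * ?F \<beta> (- (t powr \<alpha>))) (at t)" if "t > 0" for t
    unfolding G_def by (rule powr_mittag_leffler_deriv[OF assms(1,3) that])
  have H: "(H has_real_derivative G t) (at t)" if "t > 0" for t
    using powr_mittag_leffler_deriv[OF assms(1) _ that, of "\<beta> + 1"] assms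
    by (simp add: G_def H_def[abs_def] add.assoc)
  have G_mono: "G s \<le> G t" if "0 < s" "s \<le> t" for s t
    using that nonneg by (intro DERIV_nonneg_imp_nondecreasing[of s t G]) (force intro!: G)+

  obtain D where "(?F (\<beta> + 1) has_real_derivative D) (at 0)"
    using mittag_leffler_real_deriv[OF assms(1,3)] by blast
  from DERIV_isCont[OF this] have "?F (\<beta> + 1) \<midarrow>0\<rightarrow> rGamma (\<beta> + 1)"
    by (simp add: isCont_def mittag_leffler_real_0)
  hence "\<forall>\<^sub>F x in at 0. ?F (\<beta> + 1) x > 0"
    by (rule order_tendstoD) (use assms in \<open>auto intro: rGamma_real_pos\<close>)
  then obtain d where d: "d > 0" "\<And>x. x \<noteq> 0 \<Longrightarrow> \<bar>x\<bar> < d \<Longrightarrow> ?F (\<beta> + 1) x > 0"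
    unfolding eventually_at by (auto simp: dist_real_def)
  \<comment> \<open>Chosen so that -t0^\<alpha> = -d/2 lies where \<open>?F (\<beta> + 1)\<close> is
    positive; this makes the slope \<open>g\<close> positive.\<close>
  define t0 where "t0 = (d / 2) powr (1 / \<alpha>)"
  have t0: "t0 > 0" "t0 powr \<alpha> = d / 2"
    using d assms by (auto simp: t0_def powr_powr)
  define g where "g = G t0"
  have g: "g > 0" using d(2)[of "-(d/2)"] d t0 by (simp add: g_def G_def)

  have lower: "H t0 + g * (t - t0) \<le> H t" if "t \<ge> t0" for t
  proof -
    have "H t0 - g * t0 \<le> H t - g * t"
    proof (rule DERIV_nonneg_imp_nondecreasing[OF that], intro exI conjI)
      fix s assume s: "t0 \<le> s"
      show "((\<lambda>t. H t - g * t) has_real_derivative G s - g) (at s)"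
        using s t0 by (auto intro!: derivative_eq_intros H)
      show "0 \<le> G s - g" using G_mono[of t0 s] s t0 by (simp add: g_def)
    qed
    thus ?thesis by (simp add: algebra_simps)
  qed

  have upper: "H t \<le> rGamma (\<beta> + 2 - \<alpha>) * t powr (\<beta> + 1 - \<alpha>)" if "t > 0" for t
  proof -
    \<comment> \<open>The sufficiency result applies because \<beta> + 2 - \<alpha> \<ge> \<alpha>,
      by \<alpha> \<le> 1.\<close>
    have "0 \<le> norm (mittag_leffler \<alpha> (\<beta> + 2 - \<alpha>) (of_real (- (t powr \<alpha>))))" by simp
    also have "\<dots> \<le> ?F (\<beta> + 2 - \<alpha>) (- (t powr \<alpha>))"
      using norm_mittag_leffler_le[of \<alpha> "\<beta> + 2 - \<alpha>" "of_real (- (t powr \<alpha>))"] assms by simp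
    also have "\<dots> = rGamma (\<beta> + 2 - \<alpha>) - t powr \<alpha> * ?F (\<beta> + 2) (- (t powr \<alpha>))"
      using assms by (subst mittag_leffler_real_rec) auto
    finally have "t powr (\<beta> + 1 - \<alpha>) * (t powr \<alpha> * ?F (\<beta> + 2) (- (t powr \<alpha>)))
        \<le> t powr (\<beta> + 1 - \<alpha>) * rGamma (\<beta> + 2 - \<alpha>)"
      by (intro mult_left_mono) auto
    thus ?thesis
      by (simp add: H_def mult.commute flip: mult.assoc powr_add)
  qed

  \<comment> \<open>Both bounds on \<open>H\<close> are divided by t; \<open>?Q\<close> tends to 0
    since \<beta> < \<alpha>, contradicting g > 0.\<close>
  let ?Q = "\<lambda>t. rGamma (\<beta> + 2 - \<alpha>) * t powr (\<beta> - \<alpha>) - (H t0 - g * t0) / t"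
  have "(?Q \<longlongrightarrow> rGamma (\<beta> + 2 - \<alpha>) * 0 - 0) at_top"
    using assms
    by (intro tendsto_intros tendsto_neg_powr real_tendsto_divide_at_top[of _ "H t0 - g * t0"] filterlim_ident) auto
  moreover have "\<forall>\<^sub>F t in at_top. g \<le> ?Q t"
    using eventually_ge_at_top[of t0]
  proof eventually_elim
    case (elim t)
    have t: "t > 0" using elim t0 by simp
    have "g * t \<le> rGamma (\<beta> + 2 - \<alpha>) * t powr (\<beta> + 1 - \<alpha>) - (H t0 - g * t0)"
      using lower[OF elim] upper[OF t] by (simp add: algebra_simps)
    also have "t powr (\<beta> + 1 - \<alpha>) = t powr (\<beta> - \<alpha>) * t"
      using t powr_add[of t "\<beta> - \<alpha>" 1] by (simp add: algebra_simps)
    finally show ?case using t by (simp add: field_simps)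
  qed
  ultimately have "g \<le> rGamma (\<beta> + 2 - \<alpha>) * 0 - 0"
    by (intro tendsto_lowerbound) auto
  with g show False by simp
qed

theorem corollary12:
  fixes \<alpha> \<beta> :: real
  assumes "\<alpha> > 0" and "\<beta> \<ge> 0"
  shows "(\<forall>z::complex. cmod (mittag_leffler \<alpha> \<beta> z)
            \<le> Re (mittag_leffler \<alpha> \<beta> (complex_of_real (Re z))))
         \<longleftrightarrow> (0 < \<alpha> \<and> \<alpha> \<le> 1 \<and> \<beta> \<ge> \<alpha>)"
proof -
  have Re_eq: "Re (mittag_leffler \<alpha> \<beta> (complex_of_real x)) = mittag_leffler_real \<alpha> \<beta> x" for x
    by (simp add: mittag_leffler_of_real[OF assms])
  show ?thesis
    unfolding Re_eq
  proof
    assume le: "\<forall>z. cmod (mittag_leffler \<alpha> \<beta> z) \<le> mittag_leffler_real \<alpha> \<beta> (Re z)"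
    have "\<alpha> \<le> 1"
      using not_norm_le_if_alpha_gt_1[of \<alpha> \<beta>] le assms by force
    have "mittag_leffler_real \<alpha> \<beta> x \<ge> 0" for x
      using order.trans[OF norm_ge_zero le[rule_format, of "of_real x"]] by simp
    with \<open>\<alpha> \<le> 1\<close> have "\<beta> \<ge> \<alpha>"
      using not_nonneg_if_beta_less_alpha[of \<alpha> \<beta>] assms by force
    with \<open>\<alpha> \<le> 1\<close> assms show "0 < \<alpha> \<and> \<alpha> \<le> 1 \<and> \<beta> \<ge> \<alpha>" by simp
  qed (auto intro: norm_mittag_leffler_le)
qed

end
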